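(* Let $f,g:[0,1)\to[0,1)$ be two interval exchange transformations and let $x\in[0,1)$ be arbitrary. Then $(f^i(g^{-1}(x)))_{i=1}^\infty$ is a low-discrepancy sequence if and only if $((g\circ f\circ g^{-1})^i(x))_{i=1}^\infty$ is a low-discrepancy sequence.
   Context: An interval exchange transformation is a bijection $f:[0,1)\to[0,1)$ for which there are an $n\in\mathbb{N}$ and a partition of $[0,1)$ into $n$ half-open subintervals (closed on the left, open on the right) of positive lengths, such that $f$ is a translation on each of them. The numbers of intervals of $f$ and $g$ need not coincide. $f^i$ denotes the $i$-fold iterate: $f^1=f$, $f^{i+1}=f\circ f^i$. For a sequence $P=(x_i)_{i=1}^\infty$ in $[0,1)$, the star-discrepancy of its first $N$ points is $$D_N^*(P)=\sup_{B=[0,a)\subset[0,1)}\left|\frac{|\{1\le i\le N : x_i\in B\}|}{N}-\lambda(B)\right|,$$ where the supremum is over all intervals $[0,a)\subset[0,1)$ and $\lambda$ is Lebesgue measure. $P$ is called a low-discrepancy sequence if $D_N^*(P)=O(N^{-1}\log N)$ as $N\to\infty$. *)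

theory Defs
  imports "HOL-Analysis.Analysis" "HOL-Library.Landau_Symbols" "HOL-Library.Disjoint_Sets"
begin

(* A self-map of [0,1) is represented by a total function on the reals; its values outside
   [0,1) are unconstrained and play no role. *)
definition interval_exchange :: "(real \<Rightarrow> real) \<Rightarrow> bool" where
  "interval_exchange f \<longleftrightarrow>
     bij_betw f {0..<1} {0..<1} \<and>
     (\<exists>\<P>. finite \<P> \<and> partition_on {0..<1} \<P> \<and>
        (\<forall>J\<in>\<P>. (\<exists>a b. a < b \<and> J = {a..<b}) \<and> (\<exists>c. \<forall>x\<in>J. f x = x + c)))"

(* Sequences are indexed from 1: the value P 0 is never used. The bound a = 1 is admitted;
   for N \<ge> 1 and points in [0,1) it contributes the value 0. For each N all the terms are
   bounded, so the supremum is a genuine one. *)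
definition star_discrepancy :: "(nat \<Rightarrow> real) \<Rightarrow> nat \<Rightarrow> real" where
  "star_discrepancy P N =
     (SUP a\<in>{0..1}. \<bar>real (card {i\<in>{1..N}. P i \<in> {0..<a}}) / real N - measure lborel {0..<a}\<bar>)"

definition low_discrepancy :: "(nat \<Rightarrow> real) \<Rightarrow> bool" where
  "low_discrepancy P \<longleftrightarrow> star_discrepancy P \<in> O(\<lambda>N. ln (real N) / real N)"

end

theory Submission
  imports Defs
begin

text \<open>
  With \<open>y = g\<inverse>(x)\<close>, the orbit of \<open>x\<close> under \<open>g \<circ> f \<circ> g\<inverse>\<close> is the \<open>g\<close>-image of the orbit of \<open>y\<close>
  under \<open>f\<close>, so it is enough that an interval exchange \<open>g\<close> and its inverse both preserve the order
  of magnitude of the star-discrepancy of a sequence in \<open>[0,1)\<close>. The deviation of an empirical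
  frequency from Lebesgue measure is a signed measure on \<open>[0,1)\<close>. If \<open>g\<close> exchanges \<open>n\<close> intervals,
  then \<open>[0,a)\<close> splits into at most \<open>n\<close> intervals, each of which is a translate under \<open>g\<close> of an
  interval in the domain; there the points \<open>g(P\<^sub>i)\<close> deviate exactly as much as the points \<open>P\<^sub>i\<close> do on
  the preimage. An interval is a difference of two intervals anchored at \<open>0\<close>, so each piece
  contributes at most \<open>2 D\<^sub>N\<^sup>*(P)\<close>, whence \<open>D\<^sub>N\<^sup>*(g \<circ> P) \<le> 2 n D\<^sub>N\<^sup>*(P)\<close>
  (\<open>star_discrepancy_interval_exchange_le\<close>). Since \<open>g\<inverse>\<close> is again an interval exchange
  (\<open>interval_exchange_inv_into\<close>), the same bound applied to it gives the converse.
\<close>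

section \<open>The deviation from Lebesgue measure as an additive set function\<close>

text \<open>
  For \<open>N = 0\<close> the division convention turns this into minus Lebesgue measure, so that it is
  additive for every \<open>N\<close>.
\<close>
definition local_discrepancy :: "(nat \<Rightarrow> real) \<Rightarrow> nat \<Rightarrow> real set \<Rightarrow> real" where
  "local_discrepancy P N B =
     real (card {i\<in>{1..N}. P i \<in> B}) / real N - measure lborel B"

lemma local_discrepancy_empty [simp]: "local_discrepancy P N {} = 0"
  by (simp add: local_discrepancy_def)

lemma local_discrepancy_UN:
  assumes "finite I" and "disjoint_family_on B I"
    and "\<And>j. j \<in> I \<Longrightarrow> B j \<in> fmeasurable lborel"
  shows "local_discrepancy P N (\<Union>j\<in>I. B j) = (\<Sum>j\<in>I. local_discrepancy P N (B j))"
proof -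
  have "card {i\<in>{1..N}. P i \<in> (\<Union>j\<in>I. B j)} = card (\<Union>j\<in>I. {i\<in>{1..N}. P i \<in> B j})"
    by (rule arg_cong[where f = card]) auto
  also have "\<dots> = (\<Sum>j\<in>I. card {i\<in>{1..N}. P i \<in> B j})"
    using assms(1,2) by (intro card_UN_disjoint) (auto simp: disjoint_family_on_def)
  finally have "real (card {i\<in>{1..N}. P i \<in> (\<Union>j\<in>I. B j)})
      = (\<Sum>j\<in>I. real (card {i\<in>{1..N}. P i \<in> B j}))"
    by simp
  moreover have "measure lborel (\<Union>j\<in>I. B j) = (\<Sum>j\<in>I. measure lborel (B j))"
    using assms
    by (intro measure_finite_Union) (auto simp: fmeasurable_def dest: less_imp_neq)
  ultimately show ?thesis
    by (simp add: local_discrepancy_def sum_subtractf sum_divide_distrib)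
qed

lemma fmeasurable_atLeastLessThan: "{u..<v::real} \<in> fmeasurable lborel"
  by (cases "u \<le> v") (auto simp: fmeasurable_def)

lemma abs_local_discrepancy_anchored_le:
  assumes "0 \<le> a" "a \<le> 1"
  shows "\<bar>local_discrepancy P N {0..<a}\<bar> \<le> star_discrepancy P N"
proof -
  have "\<bar>local_discrepancy P N {0..<b}\<bar> \<le> 2" if "0 \<le> b" "b \<le> 1" for b
  proof -
    have "card {i\<in>{1..N}. P i \<in> {0..<b}} \<le> card {1..N}"
      by (intro card_mono) auto
    then have "real (card {i\<in>{1..N}. P i \<in> {0..<b}}) / real N \<le> 1"
      by (simp add: divide_le_eq)
    moreover have "0 \<le> real (card {i\<in>{1..N}. P i \<in> {0..<b}}) / real N"
      by simp
    ultimately show ?thesis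
      using that unfolding local_discrepancy_def measure_lborel_Ico[OF that(1)] by linarith
  qed
  then have "bdd_above ((\<lambda>b. \<bar>local_discrepancy P N {0..<b}\<bar>) ` {0..1})"
    by (intro bdd_aboveI2[where M = 2]) auto
  then show ?thesis
    using assms unfolding star_discrepancy_def local_discrepancy_def
    by (intro cSUP_upper) auto
qed

lemma abs_local_discrepancy_interval_le:
  assumes "0 \<le> u" "v \<le> 1"
  shows "\<bar>local_discrepancy P N {u..<v}\<bar> \<le> 2 * star_discrepancy P N"
proof (cases "u \<le> v")
  case True
  have "local_discrepancy P N (\<Union>b\<in>{True, False}. if b then {0..<u} else {u..<v})
      = (\<Sum>b\<in>{True, False}. local_discrepancy P N (if b then {0..<u} else {u..<v}))"
    by (rule local_discrepancy_UN) (auto simp: disjoint_family_on_def fmeasurable_atLeastLessThan)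
  moreover have "(\<Union>b\<in>{True, False}. if b then {0..<u} else {u..<v}) = {0..<v}"
    using True assms by auto
  ultimately have "local_discrepancy P N {0..<v}
      = local_discrepancy P N {0..<u} + local_discrepancy P N {u..<v}"
    by simp
  moreover have "\<bar>local_discrepancy P N {0..<u}\<bar> \<le> star_discrepancy P N"
    "\<bar>local_discrepancy P N {0..<v}\<bar> \<le> star_discrepancy P N"
    using True assms by (auto intro: abs_local_discrepancy_anchored_le)
  ultimately show ?thesis
    by linarith
next
  case False
  have "0 \<le> star_discrepancy P N"
    using abs_local_discrepancy_anchored_le[of 0 P N] by simp
  then show ?thesis
    using False by simp
qed

section \<open>Discrepancy under an interval exchange\<close>

text \<open>
  Injectivity makes \<open>g(P\<^sub>i)\<close> lie in the translated interval exactly when \<open>P\<^sub>i\<close> lies in the original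
  one, and translation preserves length.
\<close>
lemma local_discrepancy_translate:
  assumes "inj_on g {0..<1}" and "\<And>i. P i \<in> {0..<1}"
    and "{u..<v} \<subseteq> {0..<1}" and "\<And>x. x \<in> {u..<v} \<Longrightarrow> g x = x + c"
  shows "local_discrepancy (\<lambda>i. g (P i)) N {u + c..<v + c} = local_discrepancy P N {u..<v}"
proof -
  have "g (P i) \<in> {u + c..<v + c} \<longleftrightarrow> P i \<in> {u..<v}" for i
  proof
    assume g: "g (P i) \<in> {u + c..<v + c}"
    then have mem: "g (P i) - c \<in> {u..<v}"
      by auto
    then have "g (g (P i) - c) = g (P i)"
      using assms(4) by simp
    then have "g (P i) - c = P i"
      using assms(1-3) mem by (meson inj_onD subsetD)
    with mem show "P i \<in> {u..<v}"
      by simp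
  next
    assume "P i \<in> {u..<v}"
    then show "g (P i) \<in> {u + c..<v + c}"
      using assms(4)[of "P i"] by auto
  qed
  moreover have "measure lborel {u + c..<v + c} = measure lborel {u..<v}"
    by (cases "u \<le> v") simp_all
  ultimately show ?thesis
    by (simp only: local_discrepancy_def)
qed

lemma image_translate_atLeastLessThan:
  fixes a b c :: real
  assumes "\<And>x. x \<in> {a..<b} \<Longrightarrow> g x = x + c"
  shows "g ` {a..<b} = {a + c..<b + c}"
proof -
  have "g ` {a..<b} = (\<lambda>x. x + c) ` {a..<b}"
    using assms by (intro image_cong) auto
  then show ?thesis
    by simp
qed

text \<open>
  The quantitative core: the constant \<open>C = 2 n\<close>, for \<open>n\<close> exchanged intervals, depends neither on the
  sequence nor on \<open>N\<close>.
\<close>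
lemma star_discrepancy_interval_exchange_le:
  assumes "interval_exchange g"
  obtains C where "\<And>P N. (\<And>i. P i \<in> {0..<1}) \<Longrightarrow>
    star_discrepancy (\<lambda>i. g (P i)) N \<le> C * star_discrepancy P N"
proof -
  from assms obtain \<P> where bij: "bij_betw g {0..<1} {0..<1}"
    and fin: "finite \<P>" and part: "partition_on {0..<1} \<P>"
    and pieces: "\<And>J. J \<in> \<P> \<Longrightarrow> (\<exists>a b. a < b \<and> J = {a..<b}) \<and> (\<exists>c. \<forall>x\<in>J. g x = x + c)"
    unfolding interval_exchange_def by blast
  have inj: "inj_on g {0..<1}" and surj: "g ` {0..<1} = {0..<1}"
    using bij by (auto simp: bij_betw_def)
  have sub: "J \<subseteq> {0..<1}" if "J \<in> \<P>" for J
    using part that by (auto simp: partition_on_def)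
  have disj: "disjoint_family_on (\<lambda>J. g ` J \<inter> {0..<a}) \<P>" for a
  proof -
    have "g ` J \<inter> g ` K = {}" if JK: "J \<in> \<P>" "K \<in> \<P>" "J \<noteq> K" for J K
    proof -
      have "J \<inter> K = {}"
        using part JK by (auto simp: partition_on_def disjoint_def)
      then show ?thesis
        using inj_on_image_Int[OF inj sub[OF JK(1)] sub[OF JK(2)]] by simp
    qed
    then show ?thesis
      by (fastforce simp: disjoint_family_on_def)
  qed
  have "star_discrepancy (\<lambda>i. g (P i)) N \<le> 2 * real (card \<P>) * star_discrepancy P N"
    if P: "\<And>i. P i \<in> {0..<1}" for P :: "nat \<Rightarrow> real" and N
  proof -
    have "\<bar>local_discrepancy (\<lambda>i. g (P i)) N {0..<a}\<bar>
        \<le> 2 * real (card \<P>) * star_discrepancy P N"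
      if a: "0 \<le> a" "a \<le> 1" for a
    proof -
      have piece: "g ` J \<inter> {0..<a} \<in> fmeasurable lborel \<and>
          \<bar>local_discrepancy (\<lambda>i. g (P i)) N (g ` J \<inter> {0..<a})\<bar> \<le> 2 * star_discrepancy P N"
        if J: "J \<in> \<P>" for J
      proof -
        from pieces[OF J] obtain u v c where uv: "u < v" "J = {u..<v}"
          and c: "\<And>x. x \<in> J \<Longrightarrow> g x = x + c"
          by blast
        have img: "g ` J = {u + c..<v + c}"
          using c unfolding uv(2) by (rule image_translate_atLeastLessThan)
        have "g ` J \<subseteq> {0..<1}"
          using sub[OF J] surj by blast
        then have "0 \<le> u + c"
          using uv(1) unfolding img by auto
        \<comment> \<open>The translate of \<open>{u..<w}\<close> is the part of \<open>g ` J\<close> below \<open>a\<close>; it is empty when \<open>w \<le> u\<close>.\<close>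
        moreover define w where "w = min v (a - c)"
        ultimately have eq: "g ` J \<inter> {0..<a} = {u + c..<w + c}"
          unfolding img by (auto simp: min_def)
        have sub': "{u..<w} \<subseteq> J"
          unfolding uv(2) w_def by auto
        have "0 \<le> u" "v \<le> 1"
          using sub[OF J] uv by auto
        then have "\<bar>local_discrepancy P N {u..<w}\<bar> \<le> 2 * star_discrepancy P N"
          by (intro abs_local_discrepancy_interval_le) (auto simp: w_def)
        moreover have "local_discrepancy (\<lambda>i. g (P i)) N {u + c..<w + c}
            = local_discrepancy P N {u..<w}"
          using subset_trans[OF sub' sub[OF J]] subsetD[OF sub'] c
          by (intro local_discrepancy_translate inj P) blast+
        ultimately show ?thesis
          unfolding eq by (simp add: fmeasurable_atLeastLessThan)
      qed
      have "(\<Union>J\<in>\<P>. g ` J \<inter> {0..<a}) = g ` \<Union>\<P> \<inter> {0..<a}"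
        by auto
      also have "\<dots> = {0..<a}"
        using part surj a by (auto simp: partition_on_def)
      finally have "local_discrepancy (\<lambda>i. g (P i)) N {0..<a}
          = (\<Sum>J\<in>\<P>. local_discrepancy (\<lambda>i. g (P i)) N (g ` J \<inter> {0..<a}))"
        using local_discrepancy_UN[OF fin disj, of a] piece by metis
      also have "\<bar>\<dots>\<bar> \<le> (\<Sum>J\<in>\<P>. 2 * star_discrepancy P N)"
        using piece by (intro order_trans[OF sum_abs] sum_mono) auto
      finally show ?thesis
        by (simp add: mult_ac)
    qed
    then show ?thesis
      unfolding star_discrepancy_def[of "\<lambda>i. g (P i)"] local_discrepancy_def
      by (intro cSUP_least) auto
  qed
  then show ?thesis
    by (rule that)
qed

lemma low_discrepancy_interval_exchange:
  assumes "interval_exchange g" and "\<And>i. P i \<in> {0..<1}" and "low_discrepancy P"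
  shows "low_discrepancy (\<lambda>i. g (P i))"
proof -
  obtain C where C: "\<And>N. star_discrepancy (\<lambda>i. g (P i)) N \<le> C * star_discrepancy P N"
    using star_discrepancy_interval_exchange_le[OF assms(1)] assms(2) by metis
  have nonneg: "0 \<le> star_discrepancy Q N" for Q N
    using abs_local_discrepancy_anchored_le[of 0 Q N] by simp
  have "star_discrepancy (\<lambda>i. g (P i)) \<in> O(star_discrepancy P)"
    by (rule bigoI[where c = C]) (use C nonneg in auto)
  then show ?thesis
    using assms(3) unfolding low_discrepancy_def by (rule landau_o.big_trans)
qed

section \<open>Inverses and conjugation\<close>

text \<open>The images of the exchanged intervals are the intervals that the inverse exchanges.\<close>
lemma interval_exchange_inv_into:
  assumes "interval_exchange g"
  shows "interval_exchange (inv_into {0..<1} g)"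
proof -
  from assms obtain \<P> where bij: "bij_betw g {0..<1} {0..<1}"
    and fin: "finite \<P>" and part: "partition_on {0..<1} \<P>"
    and pieces: "\<And>J. J \<in> \<P> \<Longrightarrow> (\<exists>a b. a < b \<and> J = {a..<b}) \<and> (\<exists>c. \<forall>x\<in>J. g x = x + c)"
    unfolding interval_exchange_def by blast
  have inj: "inj_on g {0..<1}" and surj: "g ` {0..<1} = {0..<1}"
    using bij by (auto simp: bij_betw_def)
  have "{} \<notin> (`) g ` \<P>"
    using part by (auto simp: partition_on_def)
  then have part': "partition_on {0..<1} ((`) g ` \<P>)"
    using partition_on_inj_image[OF part inj] surj by simp
  have "(\<exists>a b. a < b \<and> g ` J = {a..<b}) \<and>
      (\<exists>c. \<forall>y\<in>g ` J. inv_into {0..<1} g y = y + c)" if J: "J \<in> \<P>" for J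
  proof -
    from pieces[OF J] obtain u v c where uv: "u < v" "J = {u..<v}"
      and c: "\<And>x. x \<in> J \<Longrightarrow> g x = x + c"
      by blast
    have "g ` J = {u + c..<v + c}"
      using c unfolding uv(2) by (rule image_translate_atLeastLessThan)
    moreover have "inv_into {0..<1} g y = y + - c" if y: "y \<in> g ` J" for y
    proof -
      from y obtain x where x: "x \<in> J" "y = g x"
        by blast
      moreover have "x \<in> {0..<1}"
        using part J x(1) by (auto simp: partition_on_def)
      ultimately show ?thesis
        using inv_into_f_f[OF inj, of x] c[of x] by simp
    qed
    ultimately show ?thesis
      using uv(1) by (metis add_less_cancel_right)
  qed
  then show ?thesis
    unfolding interval_exchange_def
    using bij_betw_inv_into[OF bij] fin part'
    by (intro conjI exI[of _ "(`) g ` \<P>"]) auto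
qed

theorem corollary1p4:
  fixes f g :: "real \<Rightarrow> real" and x :: real
  assumes "interval_exchange f" and "interval_exchange g" and "x \<in> {0..<1}"
  shows "low_discrepancy (\<lambda>i. (f ^^ i) (inv_into {0..<1} g x)) \<longleftrightarrow>
         low_discrepancy (\<lambda>i. ((g \<circ> f \<circ> inv_into {0..<1} g) ^^ i) x)"
proof -
  let ?h = "inv_into {0..<1} g"
  define P where "P = (\<lambda>i. (f ^^ i) (?h x))"
  have f: "bij_betw f {0..<1} {0..<1}" and g: "bij_betw g {0..<1} {0..<1}"
    using assms by (auto simp: interval_exchange_def)
  have hP: "?h (g y) = y" if "y \<in> {0..<1}" for y
    using g that by (rule bij_betw_inv_into_left)
  have P: "P i \<in> {0..<1}" for i
  proof (induction i)
    case 0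
    show ?case
      using bij_betwE[OF bij_betw_inv_into[OF g]] assms(3) by (simp add: P_def)
  next
    case (Suc i)
    then show ?case
      using bij_betwE[OF f] by (simp add: P_def)
  qed
  have gP: "g (P i) \<in> {0..<1}" for i
    using bij_betwE[OF g] P by blast
  have conj: "((g \<circ> f \<circ> ?h) ^^ i) x = g (P i)" for i
  proof (induction i)
    case 0
    show ?case
      using bij_betw_inv_into_right[OF g assms(3)] by (simp add: P_def)
  next
    case (Suc i)
    have "((g \<circ> f \<circ> ?h) ^^ Suc i) x = (g \<circ> f \<circ> ?h) (((g \<circ> f \<circ> ?h) ^^ i) x)"
      by simp
    also have "\<dots> = (g \<circ> f \<circ> ?h) (g (P i))"
      by (simp only: Suc)
    also have "\<dots> = g (P (Suc i))"
      using hP[OF P[of i]] by (simp add: P_def)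
    finally show ?case .
  qed
  have "low_discrepancy P \<longleftrightarrow> low_discrepancy (\<lambda>i. g (P i))"
  proof
    assume "low_discrepancy P"
    with assms(2) P show "low_discrepancy (\<lambda>i. g (P i))"
      by (rule low_discrepancy_interval_exchange)
  next
    assume "low_discrepancy (\<lambda>i. g (P i))"
    with interval_exchange_inv_into[OF assms(2)] gP
    have "low_discrepancy (\<lambda>i. ?h (g (P i)))"
      by (rule low_discrepancy_interval_exchange)
    then show "low_discrepancy P"
      using hP[OF P] by simp
  qed
  then show ?thesis
    unfolding conj by (simp add: P_def)
qed

end
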